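(* Let $a,b,c$ be integers and $r,s,t$ real numbers, let $(V_n)_{n\ge 0}$ be the associated generalized Tribonacci sequence, and let $\varphi_n$ be the $n$th generalized Tribonacci hyperbolic spinor. Assume that the complex roots $\sigma_1,\sigma_2,\sigma_3$ of $x^3-rx^2-sx-t=0$ are pairwise distinct. Then for all $n\ge 0$, $$\varphi_n=\frac{\zeta_1\Phi_1\sigma_1^{n}}{(\sigma_1-\sigma_2)(\sigma_1-\sigma_3)}+\frac{\zeta_2\Phi_2\sigma_2^{n}}{(\sigma_2-\sigma_1)(\sigma_2-\sigma_3)}+\frac{\zeta_3\Phi_3\sigma_3^{n}}{(\sigma_3-\sigma_1)(\sigma_3-\sigma_2)},$$ where, for $k=1,2,3$, $$\zeta_k=\begin{bmatrix}1+\sigma_k^3 j\\ (-1+\sigma_k j)\sigma_k\end{bmatrix},$$ and $\Phi_1=c-(\sigma_2+\sigma_3)b+\sigma_2\sigma_3a$, $\Phi_2=c-(\sigma_1+\sigma_3)b+\sigma_1\sigma_3a$, $\Phi_3=c-(\sigma_1+\sigma_2)b+\sigma_1\sigma_2a$.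
   Context: Hyperbolic numbers are the elements $x+yj$ with $x,y\in\mathbb{R}$ and $j^2=1$ (a commutative ring). A hyperbolic spinor is a column vector with two hyperbolic number components; addition and scalar multiplication are componentwise. Since the $\sigma_k$ may be non-real, the right-hand side is computed with complex coefficients, i.e. in columns over the commutative ring $\mathbb{C}[j]/(j^2-1)$, which contains the hyperbolic numbers. Given integers $a,b,c$ and real numbers $r,s,t$, the generalized Tribonacci sequence $(V_n)_{n\ge0}$ is defined by $V_0=a$, $V_1=b$, $V_2=c$ and $V_n=rV_{n-1}+sV_{n-2}+tV_{n-3}$ for $n\ge 3$. The $n$th generalized Tribonacci hyperbolic spinor is $\varphi_n=\begin{bmatrix} V_n+V_{n+3}j\\ -V_{n+1}+V_{n+2}j\end{bmatrix}$, $n\ge 0$. Convention: $0^0=1$. *)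

theory Defs
  imports "HOL-Analysis.Finite_Cartesian_Product" "HOL-Analysis.Cartesian_Space"
begin

text \<open>
  \<open>Hyp x y\<close> stands for \<open>x + y j\<close> with \<open>j\<^sup>2 = 1\<close>, i.e. \<open>'a hyp\<close> is the ring
  \<open>'a[j] / (j\<^sup>2 - 1)\<close>. The hyperbolic numbers are \<open>real hyp\<close>; \<open>complex hyp\<close> is the ring
  in which Binet-type formulas with non-real characteristic roots are computed.
\<close>

datatype 'a hyp = Hyp (hyp_fst: 'a) (hyp_snd: 'a)

instantiation hyp :: (comm_ring_1) comm_ring_1
begin

definition zero_hyp :: "'a hyp" where "0 = Hyp 0 0"

definition one_hyp :: "'a hyp" where "1 = Hyp 1 0"

definition plus_hyp :: "'a hyp \<Rightarrow> 'a hyp \<Rightarrow> 'a hyp" where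
  "z + w = Hyp (hyp_fst z + hyp_fst w) (hyp_snd z + hyp_snd w)"

definition uminus_hyp :: "'a hyp \<Rightarrow> 'a hyp" where
  "- z = Hyp (- hyp_fst z) (- hyp_snd z)"

definition minus_hyp :: "'a hyp \<Rightarrow> 'a hyp \<Rightarrow> 'a hyp" where
  "z - w = Hyp (hyp_fst z - hyp_fst w) (hyp_snd z - hyp_snd w)"

definition times_hyp :: "'a hyp \<Rightarrow> 'a hyp \<Rightarrow> 'a hyp" where
  "z * w = Hyp (hyp_fst z * hyp_fst w + hyp_snd z * hyp_snd w)
               (hyp_fst z * hyp_snd w + hyp_snd z * hyp_fst w)"

instance
  by standard
    (simp_all add: zero_hyp_def one_hyp_def plus_hyp_def uminus_hyp_def minus_hyp_def
      times_hyp_def hyp.expand algebra_simps)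

end

definition hyp_j :: "'a::comm_ring_1 hyp" where "hyp_j = Hyp 0 1"

definition hyp_of :: "'a::comm_ring_1 \<Rightarrow> 'a hyp" where "hyp_of x = Hyp x 0"

lemma hyp_j_square: "hyp_j * hyp_j = 1"
  by (simp add: hyp_j_def times_hyp_def one_hyp_def)

lemma Hyp_eq: "Hyp x y = hyp_of x + hyp_of y * hyp_j"
  by (simp add: hyp_j_def hyp_of_def times_hyp_def plus_hyp_def)

type_synonym hyperbolic_spinor = "real hyp ^ 2"

text \<open>The inclusion of hyperbolic spinors into columns over \<open>\<complex>[j] / (j\<^sup>2 - 1)\<close>.\<close>

definition spinor_complexify :: "hyperbolic_spinor \<Rightarrow> complex hyp ^ 2" where
  "spinor_complexify v = (\<chi> i. map_hyp complex_of_real (v $ i))"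

lemma inj_spinor_complexify: "inj spinor_complexify"
proof (rule injI)
  fix v w
  assume "spinor_complexify v = spinor_complexify w"
  then have "map_hyp complex_of_real (v $ i) = map_hyp complex_of_real (w $ i)" for i
    by (simp add: spinor_complexify_def vec_eq_iff)
  then show "v = w"
    by (metis hyp.inj_map inj_of_real injD vec_eq_iff)
qed

fun gen_tribonacci :: "int \<Rightarrow> int \<Rightarrow> int \<Rightarrow> real \<Rightarrow> real \<Rightarrow> real \<Rightarrow> nat \<Rightarrow> real" where
  "gen_tribonacci a b c r s t 0 = of_int a"
| "gen_tribonacci a b c r s t (Suc 0) = of_int b"
| "gen_tribonacci a b c r s t (Suc (Suc 0)) = of_int c"
| "gen_tribonacci a b c r s t (Suc (Suc (Suc n))) =
     r * gen_tribonacci a b c r s t (Suc (Suc n)) +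
     s * gen_tribonacci a b c r s t (Suc n) +
     t * gen_tribonacci a b c r s t n"

definition tribonacci_spinor ::
  "int \<Rightarrow> int \<Rightarrow> int \<Rightarrow> real \<Rightarrow> real \<Rightarrow> real \<Rightarrow> nat \<Rightarrow> hyperbolic_spinor" where
  "tribonacci_spinor a b c r s t n =
     (let V = gen_tribonacci a b c r s t in
      vector [hyp_of (V n) + hyp_of (V (n + 3)) * hyp_j,
              - hyp_of (V (n + 1)) + hyp_of (V (n + 2)) * hyp_j])"

definition spinor_zeta :: "complex \<Rightarrow> complex hyp ^ 2" where
  "spinor_zeta \<sigma> =
     vector [1 + hyp_of (\<sigma> ^ 3) * hyp_j,
             (- 1 + hyp_of \<sigma> * hyp_j) * hyp_of \<sigma>]"

text \<open>The arguments \<open>u\<close> and \<open>v\<close> are the two characteristic roots other than the one in question.\<close>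

definition binet_Phi :: "int \<Rightarrow> int \<Rightarrow> int \<Rightarrow> complex \<Rightarrow> complex \<Rightarrow> complex" where
  "binet_Phi a b c u v = of_int c - (u + v) * of_int b + u * v * of_int a"

end

theory Submission imports Defs begin

text \<open>
  The theorem is the scalar Binet formula read off in four places. If \<open>L\<close> is the linear functional
  on polynomials with \<open>L(x ^ n) = V n\<close>, the recurrence says that \<open>L\<close> vanishes on all multiples of
  the characteristic polynomial. Hence \<open>L\<close> sees \<open>x ^ n\<close> only through its Lagrange interpolant at
  the three distinct roots, and the Lagrange basis polynomial at \<open>\<sigma>1\<close> contributes
  \<open>L((x - \<sigma>2) * (x - \<sigma>3)) / ((\<sigma>1 - \<sigma>2) * (\<sigma>1 - \<sigma>3))\<close>, whose numerator is
  \<open>V 2 - (\<sigma>2 + \<sigma>3) * V 1 + \<sigma>2 * \<sigma>3 * V 0\<close>. This explains the constants \<open>binet_Phi\<close>.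
  Reduction to the interpolant is an induction on \<open>n\<close>: beyond the exponents \<open>0, 1, 2\<close> both sides
  satisfy the same recurrence (\<open>binet_third_order\<close>).

  The coefficients \<open>1, \<sigma> ^ 3, - \<sigma>, \<sigma>\<^sup>2\<close> in \<open>spinor_zeta \<sigma>\<close> are, up to sign, the powers of \<open>\<sigma>\<close> that
  shift the index from \<open>n\<close> to \<open>n\<close>, \<open>n + 3\<close>, \<open>n + 1\<close> and \<open>n + 2\<close>, as required by the four real
  coordinates of the spinor.
\<close>

text \<open>Each geometric sequence of a root satisfies the recurrence, hence so does the right-hand side;
  it remains to compare three initial values, where the constants are those of Lagrange
  interpolation.\<close>

lemma binet_third_order:
  fixes V :: "nat \<Rightarrow> 'a::field" and x y z r s t :: 'a
  assumes rec: "\<And>n. V (n + 3) = r * V (n + 2) + s * V (n + 1) + t * V n"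
    and x: "x ^ 3 = r * x ^ 2 + s * x + t"
    and y: "y ^ 3 = r * y ^ 2 + s * y + t"
    and z: "z ^ 3 = r * z ^ 2 + s * z + t"
    and distinct: "x \<noteq> y" "x \<noteq> z" "y \<noteq> z"
  shows "V n =
      (V 2 - (y + z) * V 1 + y * z * V 0) / ((x - y) * (x - z)) * x ^ n
    + (V 2 - (x + z) * V 1 + x * z * V 0) / ((y - x) * (y - z)) * y ^ n
    + (V 2 - (x + y) * V 1 + x * y * V 0) / ((z - x) * (z - y)) * z ^ n"
    (is "_ = ?A * _ + ?B * _ + ?C * _")
proof -
  define A B C where ABC: "A = ?A" "B = ?B" "C = ?C"
  \<comment> \<open>A single denominator is chosen so that the three initial identities become polynomial ones.\<close>
  define d where "d = (x - y) * (x - z) * (y - z)"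
  have d: "d \<noteq> 0" using distinct by (simp add: d_def)
  have Ad: "A * d = (V 2 - (y + z) * V 1 + y * z * V 0) * (y - z)"
    and Bd: "B * d = - (V 2 - (x + z) * V 1 + x * z * V 0) * (x - z)"
    and Cd: "C * d = (V 2 - (x + y) * V 1 + x * y * V 0) * (x - y)"
    using distinct by (simp_all add: ABC d_def divide_simps) (simp_all add: algebra_simps)
  have initial: "V k = A * x ^ k + B * y ^ k + C * z ^ k" if "k \<in> {0, 1, 2}" for k
  proof -
    have "(A * x ^ k + B * y ^ k + C * z ^ k) * d
        = (A * d) * x ^ k + (B * d) * y ^ k + (C * d) * z ^ k"
      by (simp add: algebra_simps)
    also have "\<dots> = V k * d"
      unfolding Ad Bd Cd unfolding d_def using that by (auto simp: algebra_simps power2_eq_square)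
    finally show ?thesis using d by simp
  qed
  have "V n = A * x ^ n + B * y ^ n + C * z ^ n"
  proof (induction n rule: less_induct)
    case (less n)
    show ?case
    proof (cases "n < 3")
      case True
      then have "n \<in> {0, 1, 2}" by auto
      then show ?thesis by (rule initial)
    next
      case False
      then obtain m where n: "n = m + 3" by (metis add.commute le_Suc_ex not_less)
      have IH: "V k = A * x ^ k + B * y ^ k + C * z ^ k" if "k < m + 3" for k
        using less that n by simp
      have "V n = A * x ^ m * (r * x ^ 2 + s * x + t) + B * y ^ m * (r * y ^ 2 + s * y + t)
          + C * z ^ m * (r * z ^ 2 + s * z + t)"
        unfolding n rec by (simp add: IH power_add power2_eq_square algebra_simps)
      also have "\<dots> = A * x ^ n + B * y ^ n + C * z ^ n"
        by (simp only: n power_add x y z mult.assoc)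
      finally show ?thesis .
    qed
  qed
  then show ?thesis by (simp add: ABC)
qed

theorem theorem3p9:
  fixes a b c :: int and r s t :: real and \<sigma>1 \<sigma>2 \<sigma>3 :: complex and n :: nat
  assumes roots: "{x :: complex. x ^ 3 - of_real r * x ^ 2 - of_real s * x - of_real t = 0} = {\<sigma>1, \<sigma>2, \<sigma>3}"
    and distinct: "\<sigma>1 \<noteq> \<sigma>2" "\<sigma>1 \<noteq> \<sigma>3" "\<sigma>2 \<noteq> \<sigma>3"
  shows "spinor_complexify (tribonacci_spinor a b c r s t n) =
      hyp_of (binet_Phi a b c \<sigma>2 \<sigma>3 * \<sigma>1 ^ n / ((\<sigma>1 - \<sigma>2) * (\<sigma>1 - \<sigma>3))) *s spinor_zeta \<sigma>1
    + hyp_of (binet_Phi a b c \<sigma>1 \<sigma>3 * \<sigma>2 ^ n / ((\<sigma>2 - \<sigma>1) * (\<sigma>2 - \<sigma>3))) *s spinor_zeta \<sigma>2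
    + hyp_of (binet_Phi a b c \<sigma>1 \<sigma>2 * \<sigma>3 ^ n / ((\<sigma>3 - \<sigma>1) * (\<sigma>3 - \<sigma>2))) *s spinor_zeta \<sigma>3"
proof -
  define V where "V m = complex_of_real (gen_tribonacci a b c r s t m)" for m
  define A B C where ABC: "A = binet_Phi a b c \<sigma>2 \<sigma>3 / ((\<sigma>1 - \<sigma>2) * (\<sigma>1 - \<sigma>3))"
    "B = binet_Phi a b c \<sigma>1 \<sigma>3 / ((\<sigma>2 - \<sigma>1) * (\<sigma>2 - \<sigma>3))"
    "C = binet_Phi a b c \<sigma>1 \<sigma>2 / ((\<sigma>3 - \<sigma>1) * (\<sigma>3 - \<sigma>2))"
  have root: "\<sigma> ^ 3 = of_real r * \<sigma> ^ 2 + of_real s * \<sigma> + of_real t" if "\<sigma> \<in> {\<sigma>1, \<sigma>2, \<sigma>3}" for \<sigma>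
    using that unfolding roots[symmetric] by (simp add: algebra_simps)
  have rec: "V (m + 3) = of_real r * V (m + 2) + of_real s * V (m + 1) + of_real t * V m" for m
    by (simp add: V_def numeral_3_eq_3)
  have V_init: "V 0 = of_int a" "V 1 = of_int b" "V 2 = of_int c"
    by (simp_all add: V_def numeral_2_eq_2)
  have binet: "V m = A * \<sigma>1 ^ m + B * \<sigma>2 ^ m + C * \<sigma>3 ^ m" for m
    using binet_third_order[of V, OF rec root root root distinct, of m]
    unfolding ABC binet_Phi_def V_init by simp
  have coordinates: "spinor_complexify (tribonacci_spinor a b c r s t n)
      = vector [Hyp (V n) (V (n + 3)), Hyp (- V (n + 1)) (V (n + 2))]"
    by (simp add: spinor_complexify_def tribonacci_spinor_def V_def vec_eq_iff forall_2
        plus_hyp_def times_hyp_def uminus_hyp_def hyp_of_def hyp_j_def Let_def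
        del: gen_tribonacci.simps)
  have zeta: "spinor_zeta \<sigma> = vector [Hyp 1 (\<sigma> ^ 3), Hyp (- \<sigma>) (\<sigma> ^ 2)]" for \<sigma>
    by (simp add: spinor_zeta_def plus_hyp_def times_hyp_def uminus_hyp_def one_hyp_def
        hyp_of_def hyp_j_def power2_eq_square)
  have "spinor_complexify (tribonacci_spinor a b c r s t n)
      = hyp_of (A * \<sigma>1 ^ n) *s spinor_zeta \<sigma>1 + hyp_of (B * \<sigma>2 ^ n) *s spinor_zeta \<sigma>2
        + hyp_of (C * \<sigma>3 ^ n) *s spinor_zeta \<sigma>3"
    unfolding coordinates zeta binet
    by (simp add: vec_eq_iff forall_2 plus_hyp_def times_hyp_def hyp_of_def power_add power2_eq_square
        algebra_simps)
  then show ?thesis by (simp add: ABC)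
qed

end
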